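(* Let $(E,E_+,\{p_\alpha\}_{\alpha\in A})$ be a calibrated ordered space with a closed cone $E_+$. Then the following are equivalent. (1) For any $\alpha\in A$ and $x_0\in E$ there exists a $p_\alpha$-state $f\in E'_{\alpha,+,1}$ with $|f(x_0)|=p_\alpha(x_0)$. (2) For any $\alpha\in A$ and any $x\in E$ at least one of the following properties holds: $p_\alpha(x+l)\ge p_\alpha(x)$ for all $l\in E_+$; or $p_\alpha(x-l)\ge p_\alpha(x)$ for all $l\in E_+$. (3) For each $\alpha\in A$ the unit ball of $p_\alpha$ is full; i.e. for any $\alpha\in A$ and $a\le x\le b$ in $E$ with $p_\alpha(a),p_\alpha(b)\le 1$ we have $p_\alpha(x)\le 1$. (4) For all $x,y,z\in E$ with $x\le y\le z$ and any $\alpha\in A$ we have $p_\alpha(y)\le\max\{p_\alpha(x),p_\alpha(z)\}$. (5) For any $\alpha\in A$ and $u\in E'_\alpha$ there exist $v_1,v_2\in E'_{\alpha,+}$ such that $u=v_1-v_2$ and $|u|_\alpha=|v_1|_\alpha+|v_2|_\alpha$. (6) For any $\alpha\in A$ and $x_0\in E$ the equality $\sup_{f\in E'_{\alpha,+,1}}|f(x_0)|=p_\alpha(x_0)$ holds.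
   Context: All vector spaces are real. An ordered space $(E,E_+)$ is a vector space $E$ with a cone $E_+$: $\alpha x_1+\beta x_2\in E_+$ for $x_1,x_2\in E_+$, $\alpha,\beta\ge 0$, and $E_+\cap(-E_+)=\{0\}$; $x\le y$ means $y-x\in E_+$. A calibrated ordered space $(E,E_+,\{p_\alpha\}_{\alpha\in A})$ is an ordered space with a locally convex topology together with a specified family of continuous seminorms generating the topology, such that $p_\alpha(x)=0$ for all $\alpha\in A$ implies $x=0$. A linear functional is positive if it is nonnegative on $E_+$. $E'_\alpha$ is the space of linear $f\colon E\to\mathbb{R}$ for which there is $C\ge0$ with $|f(x)|\le Cp_\alpha(x)$ for all $x\in E$, and $|f|_\alpha$ is the infimum of such $C$. $E'_{\alpha,+}$ is the set of positive $f\in E'_\alpha$; $E'_{\alpha,+,1}$ is the set of $f\in E'_{\alpha,+}$ with $|f|_\alpha\le 1$. A $p_\alpha$-state is an $f\in E'_{\alpha,+}$ with $|f|_\alpha=1$.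
   Formalization: The equivalence of (1) with the other conditions is stated only when no seminorm p_α is identically zero; if some p_α = 0 there is no p_α-state, so (1) fails while (2)–(6) may hold. Conditions (2)–(6) are shown equivalent without this assumption. *)

theory Defs
  imports "HOL-Analysis.Analysis"
begin

definition ordering_cone :: "'e::real_vector set \<Rightarrow> bool" where
  "ordering_cone K \<longleftrightarrow>
     (\<forall>x\<in>K. \<forall>y\<in>K. \<forall>a\<ge>0. \<forall>b\<ge>0. a *\<^sub>R x + b *\<^sub>R y \<in> K) \<and> K \<inter> uminus ` K = {0}"

definition cone_le :: "'e::real_vector set \<Rightarrow> 'e \<Rightarrow> 'e \<Rightarrow> bool" where
  "cone_le K x y \<longleftrightarrow> y - x \<in> K"

definition full_set :: "'e::real_vector set \<Rightarrow> 'e set \<Rightarrow> bool" where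
  "full_set K S \<longleftrightarrow> (\<forall>a\<in>S. \<forall>b\<in>S. \<forall>x. cone_le K a x \<and> cone_le K x b \<longrightarrow> x \<in> S)"

definition seminorm :: "('e::real_vector \<Rightarrow> real) \<Rightarrow> bool" where
  "seminorm q \<longleftrightarrow> (\<forall>x. 0 \<le> q x) \<and> (\<forall>c x. q (c *\<^sub>R x) = \<bar>c\<bar> * q x) \<and>
     (\<forall>x y. q (x + y) \<le> q x + q y)"

(* The locally convex topology is determined by its generating family of
   seminorms, so it is not carried as a separate component.  UNIV is added to
   the subbase only to keep the topological space equal to the whole space
   when the family is empty. *)
definition seminorm_topology ::
    "'i set \<Rightarrow> ('i \<Rightarrow> 'e::real_vector \<Rightarrow> real) \<Rightarrow> 'e topology" where
  "seminorm_topology A p =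
     topology_generated_by (insert UNIV {{y. p \<alpha> (y - x) < r} | \<alpha> x r. \<alpha> \<in> A \<and> 0 < r})"

locale calibrated_ordered_space =
  fixes K :: "'e::real_vector set"
    and A :: "'i set"
    and p :: "'i \<Rightarrow> 'e \<Rightarrow> real"
  assumes cone: "ordering_cone K"
    and seminorms: "\<alpha> \<in> A \<Longrightarrow> seminorm (p \<alpha>)"
    and separating: "(\<And>\<alpha>. \<alpha> \<in> A \<Longrightarrow> p \<alpha> x = 0) \<Longrightarrow> x = 0"

(* For q = p \<alpha>, the next five definitions give E'_\<alpha>, the number |f|_\<alpha>,
   E'_{\<alpha>,+}, E'_{\<alpha>,+,1} and the p_\<alpha>-states. *)
definition seminorm_dual :: "('e::real_vector \<Rightarrow> real) \<Rightarrow> ('e \<Rightarrow> real) set" where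
  "seminorm_dual q = {f. linear f \<and> (\<exists>C\<ge>0. \<forall>x. \<bar>f x\<bar> \<le> C * q x)}"

(* The infimum is the intended one only for f in seminorm_dual q. *)
definition dual_seminorm :: "('e::real_vector \<Rightarrow> real) \<Rightarrow> ('e \<Rightarrow> real) \<Rightarrow> real" where
  "dual_seminorm q f = Inf {C. 0 \<le> C \<and> (\<forall>x. \<bar>f x\<bar> \<le> C * q x)}"

definition positive_dual ::
    "'e::real_vector set \<Rightarrow> ('e \<Rightarrow> real) \<Rightarrow> ('e \<Rightarrow> real) set" where
  "positive_dual K q = {f \<in> seminorm_dual q. \<forall>x\<in>K. 0 \<le> f x}"

definition positive_dual_ball ::
    "'e::real_vector set \<Rightarrow> ('e \<Rightarrow> real) \<Rightarrow> ('e \<Rightarrow> real) set" where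
  "positive_dual_ball K q = {f \<in> positive_dual K q. dual_seminorm q f \<le> 1}"

definition is_state ::
    "'e::real_vector set \<Rightarrow> ('e \<Rightarrow> real) \<Rightarrow> ('e \<Rightarrow> real) \<Rightarrow> bool" where
  "is_state K q f \<longleftrightarrow> f \<in> positive_dual K q \<and> dual_seminorm q f = 1"

end

theory Submission
  imports Defs
begin

text \<open>
  Conditions \<open>c2\<close> to \<open>c6\<close> are equivalent for each seminorm separately, so the argument concerns a
  single seminorm \<open>q\<close> and a convex cone \<open>K\<close>.  Everything analytic comes from one algebraic
  extension principle of Mazur and Orlicz (\<open>sublinear_sandwich\<close>): if a sublinear \<open>g\<close> lies above
  prescribed lower bounds \<open>r\<close> at points \<open>c\<close>, and the pairs \<open>(c, r)\<close> form a convex cone, then some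
  linear functional lies below \<open>g\<close> and satisfies all the lower bounds.  Lower bounds \<open>0\<close> on \<open>K\<close>
  express positivity; a lower bound on a subspace is an equality there.

  Conditions \<open>c2\<close>, \<open>c3\<close> and \<open>c4\<close> are elementary reformulations of one another: failure of \<open>c2\<close> at
  \<open>x\<close> gives \<open>l\<close> and \<open>m\<close> in \<open>K\<close> with both \<open>q (x + l)\<close> and \<open>q (x - m)\<close> below \<open>q x\<close>, although
  \<open>x - m \<le> x \<le> x + l\<close>, which is exactly a failure of \<open>c4\<close>.

  If \<open>q (x + l) \<ge> q x\<close> on \<open>K\<close>, then the lower bounds ``\<open>q x\<close> at \<open>x\<close>, and \<open>0\<close> on \<open>K\<close>'' are
  compatible with \<open>q\<close>, and the resulting positive functional attains \<open>q x\<close> at \<open>x\<close>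
  (\<open>norming_positive_functional\<close>).  Together with the same argument for \<open>- x\<close> this gives \<open>c6\<close> and,
  as soon as \<open>q\<close> is not identically zero, \<open>c1\<close>.  Conversely a positive functional is monotone, so
  its absolute value at \<open>y\<close> is bounded by the larger of those at two points enclosing \<open>y\<close>, whence
  \<open>c6\<close> implies \<open>c4\<close>.

  The decomposition \<open>c5\<close> is a statement about one functional on \<open>E \<times> E\<close>: a pair \<open>v1\<close>, \<open>v2\<close> is the
  functional \<open>(z, x) \<mapsto> v1 z - v2 x\<close>, the equation \<open>u = v1 - v2\<close> prescribes it on the diagonal, and
  \<open>|v1| + |v2| \<le> N\<close> means that it is dominated by \<open>N * max (q z) (q x)\<close>.  Condition \<open>c4\<close> says
  exactly that these requirements are compatible with positivity of \<open>v1\<close> and \<open>v2\<close>, so the extension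
  principle produces the decomposition.  Conversely \<open>c5\<close>, applied to a functional attaining \<open>q\<close> at
  the middle one of three points \<open>x \<le> y \<le> z\<close>, gives \<open>c4\<close>.
\<close>

section \<open>Linear functionals below a sublinear functional\<close>

definition sublinear :: "('a::real_vector \<Rightarrow> real) \<Rightarrow> bool" where
  "sublinear g \<longleftrightarrow> (\<forall>x y. g (x + y) \<le> g x + g y) \<and> (\<forall>c\<ge>0. \<forall>x. g (c *\<^sub>R x) = c * g x)"

text \<open>
  One inequality suffices for homogeneity, since scaling by \<open>1 / c\<close> gives the other one.
\<close>

lemma sublinearI:
  fixes g :: "'a::real_vector \<Rightarrow> real"
  assumes add: "\<And>x y. g (x + y) \<le> g x + g y"
    and zero: "g 0 = 0"
    and scale: "\<And>c x. c > 0 \<Longrightarrow> g (c *\<^sub>R x) \<le> c * g x"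
  shows "sublinear g"
  unfolding sublinear_def
proof (intro conjI allI impI)
  fix c :: real and x :: 'a
  assume "c \<ge> 0"
  show "g (c *\<^sub>R x) = c * g x"
  proof (cases "c = 0")
    case True
    then show ?thesis by (simp add: zero)
  next
    case False
    with \<open>c \<ge> 0\<close> have c: "c > 0" by simp
    have "g ((1 / c) *\<^sub>R (c *\<^sub>R x)) \<le> (1 / c) * g (c *\<^sub>R x)"
      using c by (intro scale) simp
    then have "c * g x \<le> g (c *\<^sub>R x)"
      using c by (simp add: field_simps)
    with scale[OF c, of x] show ?thesis by simp
  qed
qed (rule add)

lemma sublinear_add: "sublinear g \<Longrightarrow> g (x + y) \<le> g x + g y"
  and sublinear_scale: "sublinear g \<Longrightarrow> c \<ge> 0 \<Longrightarrow> g (c *\<^sub>R x) = c * g x"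
  by (simp_all add: sublinear_def)

lemma sublinear_0: "sublinear g \<Longrightarrow> g 0 = 0"
  using sublinear_scale[of g 0 0] by simp

lemma sublinear_minus_le: "sublinear g \<Longrightarrow> - g (- x) \<le> g x"
  using sublinear_add[of g x "- x"] sublinear_0[of g] by simp

text \<open>
  A linear \<open>F \<le> g\<close> with \<open>F c \<ge> r\<close> satisfies \<open>F x \<le> g (x + c) - r\<close>, so the infimum of the
  right-hand sides is the largest room left for \<open>F\<close>.  The lower bounds have thereby been absorbed
  into a smaller sublinear functional, which takes a value at most \<open>- r\<close> at \<open>- c\<close>.
\<close>

lemma sublinear_absorb_lower_bounds:
  fixes g :: "'a::real_vector \<Rightarrow> real"
  assumes g: "sublinear g" and D: "convex_cone D"
    and le: "\<And>c r. (c, r) \<in> D \<Longrightarrow> r \<le> g c"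
  obtains h where "sublinear h" "\<And>x. h x \<le> g x" "\<And>c r. (c, r) \<in> D \<Longrightarrow> h (- c) \<le> - r"
proof
  define h where "h x = (INF d\<in>D. g (x + fst d) - snd d)" for x
  have 0: "0 \<in> D" using D by (simp add: convex_cone_iff)
  have lb: "- g (- x) \<le> g (x + fst d) - snd d" if "d \<in> D" for x d
    using sublinear_add[OF g, of "x + fst d" "- x"] le[of "fst d" "snd d"] that by simp
  have bdd: "bdd_below ((\<lambda>d. g (x + fst d) - snd d) ` D)" for x
    using lb by (intro bdd_belowI2[where m = "- g (- x)"])
  have upper: "h x \<le> g (x + fst d) - snd d" if "d \<in> D" for x d
    unfolding h_def using bdd that by (rule cINF_lower)
  have lower: "m \<le> h x" if "\<And>d. d \<in> D \<Longrightarrow> m \<le> g (x + fst d) - snd d" for m x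
    unfolding h_def using 0 that by (intro cINF_greatest) auto
  show "h x \<le> g x" for x
    using upper[OF 0, of x] by simp
  show "h (- c) \<le> - r" if "(c, r) \<in> D" for c r
    using upper[OF that, of "- c"] by (simp add: sublinear_0[OF g])
  show "sublinear h"
  proof (rule sublinearI)
    fix x y
    have step: "h (x + y) - (g (y + fst e) - snd e) \<le> g (x + fst d) - snd d"
      if "d \<in> D" "e \<in> D" for d e
    proof -
      have "d + e \<in> D" using D that by (simp add: convex_cone_iff)
      from upper[OF this, of "x + y"]
      have "h (x + y) \<le> g ((x + fst d) + (y + fst e)) - (snd d + snd e)"
        by (simp add: algebra_simps)
      also have "\<dots> \<le> g (x + fst d) + g (y + fst e) - (snd d + snd e)"
        using sublinear_add[OF g] by simp
      finally show ?thesis by simp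
    qed
    have "h (x + y) - (g (y + fst e) - snd e) \<le> h x" if "e \<in> D" for e
      using step that by (intro lower)
    then have "h (x + y) - h x \<le> h y"
      by (intro lower) (simp add: algebra_simps)
    then show "h (x + y) \<le> h x + h y" by simp
  next
    show "h 0 = 0"
    proof (rule antisym)
      show "h 0 \<le> 0" using upper[OF 0, of 0] by (simp add: sublinear_0[OF g])
      show "0 \<le> h 0" using lb[of _ 0] by (intro lower) (simp add: sublinear_0[OF g])
    qed
  next
    fix c :: real and x
    assume c: "c > 0"
    have "h (c *\<^sub>R x) / c \<le> h x"
    proof (rule lower)
      fix d assume "d \<in> D"
      then have "c *\<^sub>R d \<in> D" using D c by (simp add: convex_cone_iff)
      from upper[OF this, of "c *\<^sub>R x"]
      have "h (c *\<^sub>R x) \<le> g (c *\<^sub>R (x + fst d)) - c * snd d"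
        by (simp add: scaleR_add_right)
      also have "\<dots> = c * (g (x + fst d) - snd d)"
        using c sublinear_scale[OF g, of c "x + fst d"] by (simp add: right_diff_distrib)
      finally show "h (c *\<^sub>R x) / c \<le> g (x + fst d) - snd d"
        using c by (simp add: field_simps)
    qed
    then show "h (c *\<^sub>R x) \<le> c * h x"
      using c by (simp add: field_simps)
  qed
qed

text \<open>
  The pointwise infimum of a chain of sublinear functionals below \<open>g\<close> is finite, because each of
  them is at least \<open>- g (- x)\<close> at \<open>x\<close>.  It is subadditive because, for two members of a chain, the
  smaller one can be used at both summands.
\<close>

lemma sublinear_Inf_chain:
  fixes g :: "'a::real_vector \<Rightarrow> real"
  assumes C: "C \<noteq> {}" "\<And>a. a \<in> C \<Longrightarrow> sublinear a \<and> a \<le> g"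
    and chain: "\<And>a b. a \<in> C \<Longrightarrow> b \<in> C \<Longrightarrow> a \<le> b \<or> b \<le> a"
  obtains h where "sublinear h" "\<And>a. a \<in> C \<Longrightarrow> h \<le> a"
proof
  define h where "h x = (INF a\<in>C. a x)" for x
  have lb: "- g (- x) \<le> a x" if "a \<in> C" for a x
  proof -
    have "- g (- x) \<le> - a (- x)" using C(2)[OF that] by (simp add: le_fun_def)
    also have "\<dots> \<le> a x" using C(2)[OF that] by (simp add: sublinear_minus_le)
    finally show ?thesis .
  qed
  have upper: "h x \<le> a x" if "a \<in> C" for a x
    unfolding h_def using lb that by (intro cINF_lower bdd_belowI2[where m = "- g (- x)"]) auto
  have lower: "m \<le> h x" if "\<And>a. a \<in> C \<Longrightarrow> m \<le> a x" for m x
    unfolding h_def using C(1) that by (intro cINF_greatest)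
  show "h \<le> a" if "a \<in> C" for a
    using upper[OF that] by (simp add: le_fun_def)
  show "sublinear h"
  proof (rule sublinearI)
    fix x y
    have step: "h (x + y) - b y \<le> a x" if ab: "a \<in> C" "b \<in> C" for a b
    proof -
      from chain[OF ab] obtain c where c: "c \<in> C" "c \<le> a" "c \<le> b"
        using ab by blast
      have "h (x + y) \<le> c (x + y)" using c by (intro upper)
      also have "\<dots> \<le> c x + c y" using C(2)[OF c(1)] by (simp add: sublinear_add)
      also have "\<dots> \<le> a x + b y" using c by (intro add_mono) (auto simp: le_fun_def)
      finally show ?thesis by simp
    qed
    have "h (x + y) - b y \<le> h x" if "b \<in> C" for b
      using step that by (intro lower)
    then have "h (x + y) - h x \<le> h y"
      by (intro lower) (simp add: algebra_simps)
    then show "h (x + y) \<le> h x + h y" by simp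
  next
    have "a 0 = 0" if "a \<in> C" for a using C(2)[OF that] by (simp add: sublinear_0)
    then have "(\<lambda>a. a 0) ` C = {0}" using C(1) by force
    then show "h 0 = 0" by (simp add: h_def)
  next
    fix c :: real and x
    assume c: "c > 0"
    have "h (c *\<^sub>R x) / c \<le> h x"
    proof (rule lower)
      fix a assume a: "a \<in> C"
      have "h (c *\<^sub>R x) \<le> c * a x"
        using upper[OF a, of "c *\<^sub>R x"] C(2)[OF a] c by (simp add: sublinear_scale)
      then show "h (c *\<^sub>R x) / c \<le> a x" using c by (simp add: field_simps)
    qed
    then show "h (c *\<^sub>R x) \<le> c * h x"
      using c by (simp add: field_simps)
  qed
qed

text \<open>
  The algebraic Hahn-Banach theorem.  By Zorn's lemma there is a minimal sublinear functional \<open>m\<close>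
  below \<open>g\<close>.  Prescribing the lower bounds \<open>t * m y\<close> on the ray through \<open>y\<close> cannot decrease \<open>m\<close>
  any further; this forces superadditivity, so \<open>m\<close> is linear.
\<close>

lemma linear_below_sublinear:
  fixes g :: "'a::real_vector \<Rightarrow> real"
  assumes g: "sublinear g"
  obtains f where "linear f" "\<And>x. f x \<le> g x"
proof -
  define S where "S = {h. sublinear h \<and> h \<le> g}"
  let ?P = "\<lambda>a b :: 'a \<Rightarrow> real. b \<le> a"
  have "\<exists>m\<in>S. \<forall>a\<in>S. a \<le> m \<longrightarrow> a = m"
  proof (rule predicate_Zorn)
    show "partial_order_on S (relation_of ?P S)"
      by (rule partial_order_on_relation_ofI) auto
    show "\<exists>u\<in>S. \<forall>a\<in>C. u \<le> a" if chain: "C \<in> Chains (relation_of ?P S)" for C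
    proof (cases "C = {}")
      case True
      then show ?thesis using g by (auto simp: S_def)
    next
      case False
      have sub: "C \<subseteq> S" using chain by (rule Chains_relation_of)
      have tot: "a \<le> b \<or> b \<le> a" if "a \<in> C" "b \<in> C" for a b
        using chain that by (auto simp: Chains_def relation_of_def)
      obtain h where h: "sublinear h" "\<And>a. a \<in> C \<Longrightarrow> h \<le> a"
        using sublinear_Inf_chain[OF False, of g] sub tot unfolding S_def by blast
      obtain a where "a \<in> C" using False by blast
      then have "h \<le> g" using h(2) sub by (force simp: S_def)
      then show ?thesis using h by (auto simp: S_def)
    qed
  qed
  then obtain m where m: "sublinear m" "m \<le> g"
    and minimal: "\<And>h. sublinear h \<Longrightarrow> h \<le> m \<Longrightarrow> h = m"
    unfolding S_def by (auto intro: order_trans)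
  have neg: "m (- y) = - m y" for y
  proof -
    let ?D = "{(t *\<^sub>R y, t * m y) | t. t \<ge> 0}"
    have cone: "convex_cone ?D"
      unfolding convex_cone_iff
    proof (intro conjI ballI allI impI)
      show "0 \<in> ?D" by (auto intro!: exI[of _ 0] simp: zero_prod_def)
    next
      fix d e assume "d \<in> ?D" "e \<in> ?D"
      then obtain s t where "d = (s *\<^sub>R y, s * m y)" "s \<ge> 0" "e = (t *\<^sub>R y, t * m y)" "t \<ge> 0"
        by blast
      then show "d + e \<in> ?D"
        by (auto intro!: exI[of _ "s + t"] simp: algebra_simps)
    next
      fix d and c :: real assume "d \<in> ?D" "0 \<le> c"
      then obtain s where "d = (s *\<^sub>R y, s * m y)" "s \<ge> 0"
        by blast
      then show "c *\<^sub>R d \<in> ?D"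
        using \<open>0 \<le> c\<close> by (auto intro!: exI[of _ "c * s"])
    qed
    have le: "r \<le> m c" if "(c, r) \<in> ?D" for c r
      using that by (auto simp: sublinear_scale[OF m(1)])
    obtain h where h: "sublinear h" "\<And>x. h x \<le> m x"
        "\<And>c r. (c, r) \<in> ?D \<Longrightarrow> h (- c) \<le> - r"
      using sublinear_absorb_lower_bounds[OF m(1) cone le] by blast
    have "h = m" using h(1,2) by (intro minimal) (simp_all add: le_fun_def)
    moreover have "(y, m y) \<in> ?D" by (auto intro!: exI[of _ 1])
    ultimately have "m (- y) \<le> - m y" using h(3) by blast
    then show ?thesis using sublinear_minus_le[OF m(1), of y] by simp
  qed
  have "linear m"
  proof (rule linearI)
    fix x y
    show "m (x + y) = m x + m y"
      using sublinear_add[OF m(1), of x y] sublinear_add[OF m(1), of "x + y" "- y"]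
      by (simp add: neg)
  next
    fix c :: real and x
    show "m (c *\<^sub>R x) = c *\<^sub>R m x"
    proof (cases "c \<ge> 0")
      case True
      then show ?thesis by (simp add: sublinear_scale[OF m(1)])
    next
      case False
      then have "m ((- c) *\<^sub>R x) = (- c) * m x" by (intro sublinear_scale[OF m(1)]) simp
      then show ?thesis by (simp add: neg)
    qed
  qed
  with m(2) show thesis by (intro that) (auto simp: le_fun_def)
qed

text \<open>
  This is the form in which Hahn-Banach is applied: every family of lower bounds closed under
  addition and nonnegative scaling, and compatible with \<open>g\<close>, can be met by a linear functional.
\<close>

theorem sublinear_sandwich:
  fixes g :: "'a::real_vector \<Rightarrow> real"
  assumes "sublinear g" "convex_cone D" "\<And>c r. (c, r) \<in> D \<Longrightarrow> r \<le> g c"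
  obtains f where "linear f" "\<And>x. f x \<le> g x" "\<And>c r. (c, r) \<in> D \<Longrightarrow> r \<le> f c"
proof -
  obtain h where h: "sublinear h" "\<And>x. h x \<le> g x" "\<And>c r. (c, r) \<in> D \<Longrightarrow> h (- c) \<le> - r"
    using sublinear_absorb_lower_bounds[OF assms] by blast
  obtain f where f: "linear f" "\<And>x. f x \<le> h x"
    using linear_below_sublinear[OF h(1)] by blast
  show thesis
  proof (rule that)
    show "f x \<le> g x" for x using f(2)[of x] h(2)[of x] by simp
    show "r \<le> f c" if "(c, r) \<in> D" for c r
      using f(2)[of "- c"] h(3)[OF that] by (simp add: linear_neg[OF f(1)])
  qed (rule f(1))
qed

section \<open>Seminorms and their dual seminorms\<close>

lemma seminorm_nonneg: "seminorm q \<Longrightarrow> 0 \<le> q x"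
  and seminorm_scale: "seminorm q \<Longrightarrow> q (c *\<^sub>R x) = \<bar>c\<bar> * q x"
  and seminorm_add: "seminorm q \<Longrightarrow> q (x + y) \<le> q x + q y"
  by (simp_all add: seminorm_def)

lemma seminorm_minus: "seminorm q \<Longrightarrow> q (- x) = q x"
  using seminorm_scale[of q "-1" x] by simp

lemma seminorm_0: "seminorm q \<Longrightarrow> q 0 = 0"
  using seminorm_scale[of q 0 0] by simp

lemma seminorm_sublinear: "seminorm q \<Longrightarrow> sublinear q"
  by (simp add: seminorm_def sublinear_def)

lemma dual_seminorm_bound:
  assumes "seminorm q" "f \<in> seminorm_dual q"
  shows "\<bar>f x\<bar> \<le> dual_seminorm q f * q x"
proof -
  let ?B = "{C. 0 \<le> C \<and> (\<forall>x. \<bar>f x\<bar> \<le> C * q x)}"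
  have ne: "?B \<noteq> {}" using assms by (auto simp: seminorm_dual_def)
  show ?thesis
  proof (cases "q x = 0")
    case True
    from ne obtain C where "\<bar>f x\<bar> \<le> C * q x" by blast
    with True show ?thesis by simp
  next
    case False
    then have q: "q x > 0" using seminorm_nonneg[OF assms(1), of x] by simp
    have "\<bar>f x\<bar> / q x \<le> Inf ?B"
      using ne q by (intro cInf_greatest) (auto simp: field_simps)
    then show ?thesis using q by (simp add: dual_seminorm_def field_simps)
  qed
qed

lemma dual_seminorm_le:
  assumes "0 \<le> C" "\<And>x. \<bar>f x\<bar> \<le> C * q x"
  shows "dual_seminorm q f \<le> C"
  unfolding dual_seminorm_def using assms by (intro cInf_lower) (auto intro!: bdd_belowI[where m = 0])

lemma dual_seminorm_nonneg:
  assumes "f \<in> seminorm_dual q"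
  shows "0 \<le> dual_seminorm q f"
  unfolding dual_seminorm_def using assms
  by (intro cInf_greatest) (auto simp: seminorm_dual_def)

text \<open>
  A one-sided bound on the unit ball suffices.  Where \<open>q x = 0\<close> the whole line through \<open>x\<close> lies in
  the ball, so there \<open>f\<close> vanishes.
\<close>

lemma abs_le_of_le_on_ball:
  assumes q: "seminorm q" and f: "linear f"
    and le: "\<And>x. q x \<le> 1 \<Longrightarrow> f x \<le> C"
  shows "\<bar>f x\<bar> \<le> C * q x"
proof -
  have one: "f x \<le> C * q x" for x
  proof (cases "q x = 0")
    case True
    have "f x \<le> 0"
    proof (rule ccontr)
      assume pos: "\<not> f x \<le> 0"
      let ?t = "(\<bar>C\<bar> + 1) / f x"
      have "f (?t *\<^sub>R x) \<le> C"
        using True by (intro le) (simp add: seminorm_scale[OF q])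
      then show False using pos by (simp add: linear_scale[OF f])
    qed
    then show ?thesis using True by simp
  next
    case False
    then have pos: "q x > 0" using seminorm_nonneg[OF q, of x] by simp
    have "f ((1 / q x) *\<^sub>R x) \<le> C"
      using pos by (intro le) (simp add: seminorm_scale[OF q])
    then show ?thesis using pos by (simp add: linear_scale[OF f] field_simps)
  qed
  show ?thesis
    using one[of x] one[of "- x"] by (simp add: linear_neg[OF f] seminorm_minus[OF q])
qed

lemma abs_le_of_le_seminorm:
  assumes "seminorm q" "linear f" "\<And>x. f x \<le> q x"
  shows "\<bar>f x\<bar> \<le> q x"
  using assms(3)[of x] assms(3)[of "- x"]
  by (simp add: linear_neg[OF assms(2)] seminorm_minus[OF assms(1)])

lemma positive_dual_ball_iff:
  assumes "seminorm q"
  shows "f \<in> positive_dual_ball K q \<longleftrightarrow>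
    linear f \<and> (\<forall>x. \<bar>f x\<bar> \<le> q x) \<and> (\<forall>x\<in>K. 0 \<le> f x)"
proof
  assume f: "f \<in> positive_dual_ball K q"
  then have "f \<in> seminorm_dual q" "dual_seminorm q f \<le> 1"
    by (auto simp: positive_dual_ball_def positive_dual_def)
  then have "\<bar>f x\<bar> \<le> 1 * q x" for x
    using dual_seminorm_bound[OF assms, of f x] seminorm_nonneg[OF assms, of x]
    by (meson mult_right_mono order_trans)
  with f show "linear f \<and> (\<forall>x. \<bar>f x\<bar> \<le> q x) \<and> (\<forall>x\<in>K. 0 \<le> f x)"
    by (auto simp: positive_dual_ball_def positive_dual_def seminorm_dual_def)
next
  assume f: "linear f \<and> (\<forall>x. \<bar>f x\<bar> \<le> q x) \<and> (\<forall>x\<in>K. 0 \<le> f x)"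
  then show "f \<in> positive_dual_ball K q"
    using dual_seminorm_le[of 1 f q]
    by (auto simp: positive_dual_ball_def positive_dual_def seminorm_dual_def intro!: exI[of _ 1])
qed

section \<open>Fullness of the unit ball and one-sided monotonicity\<close>

definition le_max_between :: "'a::real_vector set \<Rightarrow> ('a \<Rightarrow> real) \<Rightarrow> bool" where
  "le_max_between K q \<longleftrightarrow>
    (\<forall>x y z. cone_le K x y \<and> cone_le K y z \<longrightarrow> q y \<le> max (q x) (q z))"

lemma le_max_betweenD:
  "le_max_between K q \<Longrightarrow> y - x \<in> K \<Longrightarrow> z - y \<in> K \<Longrightarrow> q y \<le> max (q x) (q z)"
  by (auto simp: le_max_between_def cone_le_def)

text \<open>
  Fullness is rescaled from the unit ball to balls of every radius \<open>r\<close> above the maximum.  Taking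
  \<open>r\<close> strictly larger keeps it positive when both enclosing points have seminorm zero.
\<close>

lemma full_ball_iff_le_max_between:
  assumes q: "seminorm q" and K: "convex_cone K"
  shows "full_set K {x. q x \<le> 1} \<longleftrightarrow> le_max_between K q"
proof
  assume full: "full_set K {x. q x \<le> 1}"
  show "le_max_between K q"
    unfolding le_max_between_def
  proof (intro allI impI)
    fix x y z
    assume xyz: "cone_le K x y \<and> cone_le K y z"
    show "q y \<le> max (q x) (q z)"
    proof (rule dense_ge)
      fix r assume r: "max (q x) (q z) < r"
      then have pos: "r > 0" using seminorm_nonneg[OF q, of x] by simp
      have ball: "q ((1 / r) *\<^sub>R w) \<le> 1 \<longleftrightarrow> q w \<le> r" for w
        using pos by (simp add: seminorm_scale[OF q] field_simps)
      have le: "cone_le K ((1 / r) *\<^sub>R v) ((1 / r) *\<^sub>R w)" if "cone_le K v w" for v w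
        using convex_cone_scaleR[OF K, of "1 / r" "w - v"] that pos
        by (simp add: cone_le_def scaleR_diff_right)
      have "(1 / r) *\<^sub>R y \<in> {x. q x \<le> 1}"
        using full[unfolded full_set_def, rule_format,
            of "(1 / r) *\<^sub>R x" "(1 / r) *\<^sub>R z" "(1 / r) *\<^sub>R y"] xyz le r
        by (simp add: ball less_imp_le)
      then show "q y \<le> r" using ball by simp
    qed
  qed
next
  assume "le_max_between K q"
  then show "full_set K {x. q x \<le> 1}"
    by (force simp: full_set_def le_max_between_def)
qed

lemma le_max_between_iff_one_sided:
  "le_max_between K q \<longleftrightarrow>
    (\<forall>x. (\<forall>l\<in>K. q (x + l) \<ge> q x) \<or> (\<forall>l\<in>K. q (x - l) \<ge> q x))" (is "_ \<longleftrightarrow> ?R")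
proof
  assume between: "le_max_between K q"
  show ?R
  proof (intro allI, rule ccontr)
    fix x
    assume "\<not> ((\<forall>l\<in>K. q (x + l) \<ge> q x) \<or> (\<forall>l\<in>K. q (x - l) \<ge> q x))"
    then obtain l m where "l \<in> K" "q (x + l) < q x" "m \<in> K" "q (x - m) < q x"
      by force
    then show False
      using le_max_betweenD[OF between, of x "x - m" "x + l"] by simp
  qed
next
  assume R: ?R
  show "le_max_between K q"
    unfolding le_max_between_def cone_le_def
  proof (intro allI impI)
    fix x y z
    assume xyz: "y - x \<in> K \<and> z - y \<in> K"
    from R consider "\<forall>l\<in>K. q (y + l) \<ge> q y" | "\<forall>l\<in>K. q (y - l) \<ge> q y" by blast
    then show "q y \<le> max (q x) (q z)"
    proof cases
      case 1
      with xyz have "q y \<le> q (y + (z - y))" by blast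
      then show ?thesis by simp
    next
      case 2
      with xyz have "q y \<le> q (y - (y - x))" by blast
      then show ?thesis by simp
    qed
  qed
qed

section \<open>Norming positive functionals\<close>

text \<open>
  The lower bounds are \<open>q x\<close> at \<open>x\<close> and \<open>0\<close> on \<open>K\<close>.  The cone they generate consists of the pairs
  \<open>(t x + l, t q x)\<close>, and these are compatible with \<open>q\<close> by homogeneity and the monotonicity at \<open>x\<close>.
\<close>

lemma norming_positive_functional:
  assumes q: "seminorm q" and K: "convex_cone K"
    and mono: "\<And>l. l \<in> K \<Longrightarrow> q x \<le> q (x + l)"
  obtains f where "linear f" "\<And>y. \<bar>f y\<bar> \<le> q y" "\<And>l. l \<in> K \<Longrightarrow> 0 \<le> f l" "f x = q x"
proof -
  let ?D = "{(t *\<^sub>R x + l, t * q x) | t l. t \<ge> 0 \<and> l \<in> K}"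
  have K0: "0 \<in> K" using K by (simp add: convex_cone_iff)
  have mem: "(t *\<^sub>R x + l, t * q x) \<in> ?D" if "t \<ge> 0" "l \<in> K" for t l
    using that by blast
  have cone: "convex_cone ?D"
    unfolding convex_cone_iff
  proof (intro conjI ballI allI impI)
    show "0 \<in> ?D" using mem[of 0 0] K0 by (simp add: zero_prod_def)
  next
    fix d e assume "d \<in> ?D" "e \<in> ?D"
    then obtain s l t m where "d = (s *\<^sub>R x + l, s * q x)" "s \<ge> 0" "l \<in> K"
        "e = (t *\<^sub>R x + m, t * q x)" "t \<ge> 0" "m \<in> K"
      by blast
    then show "d + e \<in> ?D"
      using mem[of "s + t" "l + m"] convex_cone_add[OF K, of l m] by (simp add: algebra_simps)
  next
    fix d and c :: real assume "d \<in> ?D" "0 \<le> c"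
    then obtain s l where "d = (s *\<^sub>R x + l, s * q x)" "s \<ge> 0" "l \<in> K"
      by blast
    then show "c *\<^sub>R d \<in> ?D"
      using mem[of "c * s" "c *\<^sub>R l"] convex_cone_scaleR[OF K, of c l] \<open>0 \<le> c\<close>
      by (simp add: scaleR_add_right)
  qed
  have compatible: "r \<le> q c" if "(c, r) \<in> ?D" for c r
  proof -
    from that obtain t l where *: "c = t *\<^sub>R x + l" "r = t * q x" "t \<ge> 0" "l \<in> K" by blast
    show ?thesis
    proof (cases "t = 0")
      case True
      then show ?thesis using * seminorm_nonneg[OF q] by simp
    next
      case False
      then have "(1 / t) *\<^sub>R l \<in> K"
        using * by (intro convex_cone_scaleR[OF K]) auto
      then have "t * q x \<le> t * q (x + (1 / t) *\<^sub>R l)"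
        using * by (intro mult_left_mono mono)
      also have "\<dots> = q (t *\<^sub>R (x + (1 / t) *\<^sub>R l))"
        using * by (simp add: seminorm_scale[OF q])
      also have "t *\<^sub>R (x + (1 / t) *\<^sub>R l) = c"
        using * False by (simp add: scaleR_add_right)
      finally show ?thesis using * by simp
    qed
  qed
  obtain f where f: "linear f" "\<And>y. f y \<le> q y" "\<And>c r. (c, r) \<in> ?D \<Longrightarrow> r \<le> f c"
    using sublinear_sandwich[OF seminorm_sublinear[OF q] cone compatible] by blast
  show thesis
  proof (rule that)
    show "\<bar>f y\<bar> \<le> q y" for y using q f(1,2) by (rule abs_le_of_le_seminorm)
    show "0 \<le> f l" if "l \<in> K" for l using f(3)[OF mem[of 0 l]] that by simp
    show "f x = q x" using f(2)[of x] f(3)[OF mem[of 1 0]] K0 by simp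
  qed (rule f(1))
qed

lemma le_max_between_norming:
  assumes q: "seminorm q" and K: "convex_cone K" and between: "le_max_between K q"
  obtains f where "f \<in> positive_dual_ball K q" "\<bar>f x\<bar> = q x"
proof -
  from between consider "\<forall>l\<in>K. q (x + l) \<ge> q x" | "\<forall>l\<in>K. q (x - l) \<ge> q x"
    unfolding le_max_between_iff_one_sided by blast
  then obtain y f where y: "y \<in> {x, - x}"
    and f: "linear f" "\<And>y. \<bar>f y\<bar> \<le> q y" "\<And>l. l \<in> K \<Longrightarrow> 0 \<le> f l" "f y = q y"
  proof cases
    case 1
    then show ?thesis
      using norming_positive_functional[OF q K, of x] that[of x] by (metis insertI1)
  next
    case 2
    have "q (- x) \<le> q (- x + l)" if "l \<in> K" for l
      using 2 that seminorm_minus[OF q, of x] seminorm_minus[OF q, of "x - l"] by simp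
    then show ?thesis
      using norming_positive_functional[OF q K, of "- x"] that[of "- x"] by (metis insertCI)
  qed
  have "\<bar>f x\<bar> = q x"
    using y f(4) seminorm_nonneg[OF q, of x]
    by (auto simp: linear_neg[OF f(1)] seminorm_minus[OF q])
  moreover have "f \<in> positive_dual_ball K q"
    using f by (simp add: positive_dual_ball_iff[OF q])
  ultimately show thesis by (intro that)
qed

text \<open>
  The supremum is attained at a norming functional.  Conversely \<open>f x \<le> f y \<le> f z\<close> for positive
  \<open>f\<close>, so \<open>|f y|\<close> is at most the larger of \<open>|f x|\<close> and \<open>|f z|\<close>.
\<close>

lemma le_max_between_iff_SUP:
  assumes q: "seminorm q" and K: "convex_cone K"
  shows "le_max_between K q \<longleftrightarrow>
    (\<forall>x. (SUP f\<in>positive_dual_ball K q. \<bar>f x\<bar>) = q x)" (is "_ \<longleftrightarrow> ?R")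
proof
  assume between: "le_max_between K q"
  show ?R
  proof
    fix x
    obtain f where f: "f \<in> positive_dual_ball K q" "\<bar>f x\<bar> = q x"
      using le_max_between_norming[OF q K between] .
    show "(SUP f\<in>positive_dual_ball K q. \<bar>f x\<bar>) = q x"
    proof (rule cSup_eq_maximum)
      show "q x \<in> (\<lambda>f. \<bar>f x\<bar>) ` positive_dual_ball K q"
        using f by (metis image_eqI)
    qed (auto simp: positive_dual_ball_iff[OF q])
  qed
next
  assume R: ?R
  have zero: "(\<lambda>_. 0) \<in> positive_dual_ball K q"
    using seminorm_nonneg[OF q]
    by (simp add: positive_dual_ball_iff[OF q] module_hom_zero linear_iff)
  show "le_max_between K q"
    unfolding le_max_between_def cone_le_def
  proof (intro allI impI)
    fix x y z
    assume xyz: "y - x \<in> K \<and> z - y \<in> K"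
    have "\<bar>f y\<bar> \<le> max (q x) (q z)" if "f \<in> positive_dual_ball K q" for f
    proof -
      have f: "linear f" "\<And>x. \<bar>f x\<bar> \<le> q x" "\<And>x. x \<in> K \<Longrightarrow> 0 \<le> f x"
        using that by (auto simp: positive_dual_ball_iff[OF q])
      have "f x \<le> f y" "f y \<le> f z"
        using f(3)[of "y - x"] f(3)[of "z - y"] xyz by (simp_all add: linear_diff[OF f(1)])
      then show ?thesis using f(2)[of x] f(2)[of z] by linarith
    qed
    then have "(SUP f\<in>positive_dual_ball K q. \<bar>f y\<bar>) \<le> max (q x) (q z)"
      using zero by (intro cSUP_least) auto
    then show "q y \<le> max (q x) (q z)" using R by simp
  qed
qed

text \<open>
  A functional attaining a nonzero value \<open>q x\<close> has dual seminorm \<open>1\<close>.  At a point where \<open>q\<close>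
  vanishes every functional in the dual ball vanishes too, so there any state serves; one exists
  because \<open>q\<close> is nonzero somewhere.
\<close>

lemma le_max_between_iff_states:
  assumes q: "seminorm q" and K: "convex_cone K" and nontrivial: "\<exists>y. q y \<noteq> 0"
  shows "le_max_between K q \<longleftrightarrow>
    (\<forall>x. \<exists>f\<in>positive_dual_ball K q. is_state K q f \<and> \<bar>f x\<bar> = q x)" (is "_ \<longleftrightarrow> ?R")
proof
  assume between: "le_max_between K q"
  have state: "\<exists>f\<in>positive_dual_ball K q. is_state K q f \<and> \<bar>f x\<bar> = q x" if x: "q x \<noteq> 0" for x
  proof -
    obtain f where f: "f \<in> positive_dual_ball K q" "\<bar>f x\<bar> = q x"
      using le_max_between_norming[OF q K between] .
    then have pos: "f \<in> positive_dual K q" "dual_seminorm q f \<le> 1"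
      by (auto simp: positive_dual_ball_def)
    have "1 * q x \<le> dual_seminorm q f * q x"
      using dual_seminorm_bound[OF q, of f x] pos f(2) by (simp add: positive_dual_def)
    moreover have "q x > 0" using x seminorm_nonneg[OF q, of x] by simp
    ultimately have "1 \<le> dual_seminorm q f" by (simp only: mult_le_cancel_right_pos)
    with f pos show ?thesis by (auto simp: is_state_def)
  qed
  show ?R
  proof
    fix x
    show "\<exists>f\<in>positive_dual_ball K q. is_state K q f \<and> \<bar>f x\<bar> = q x"
    proof (cases "q x = 0")
      case True
      obtain f where f: "f \<in> positive_dual_ball K q" "is_state K q f"
        using nontrivial state by blast
      then have "\<bar>f x\<bar> \<le> q x" by (simp add: positive_dual_ball_iff[OF q])
      with f True show ?thesis by auto
    qed (rule state)
  qed
next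
  assume R: ?R
  have "(SUP f\<in>positive_dual_ball K q. \<bar>f x\<bar>) = q x" for x
  proof (rule cSup_eq_maximum)
    show "q x \<in> (\<lambda>f. \<bar>f x\<bar>) ` positive_dual_ball K q"
      using R by (metis image_eqI)
  qed (auto simp: positive_dual_ball_iff[OF q])
  then show "le_max_between K q"
    by (simp add: le_max_between_iff_SUP[OF q K])
qed

section \<open>Decomposition of functionals\<close>

text \<open>
  The weighted maximum is the seminorm on \<open>E \<times> E\<close> whose dual unit ball consists of the pairs
  \<open>(v, w)\<close> with \<open>|v| + |w| \<le> N\<close>; one half of this duality is \<open>dual_seminorm_add_le\<close> below.
\<close>

lemma sublinear_max:
  assumes q: "seminorm q" and N: "N \<ge> 0"
  shows "sublinear (\<lambda>(z, x). N * max (q z) (q x))"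
proof (rule sublinearI)
  fix a b :: "'a \<times> 'a"
  obtain z x where a: "a = (z, x)" by force
  obtain z' x' where b: "b = (z', x')" by force
  have "max (q (z + z')) (q (x + x')) \<le> max (q z) (q x) + max (q z') (q x')"
    using seminorm_add[OF q, of z z'] seminorm_add[OF q, of x x'] by linarith
  then have "N * max (q (z + z')) (q (x + x')) \<le> N * (max (q z) (q x) + max (q z') (q x'))"
    using N by (rule mult_left_mono)
  then show "(\<lambda>(z, x). N * max (q z) (q x)) (a + b) \<le>
      (\<lambda>(z, x). N * max (q z) (q x)) a + (\<lambda>(z, x). N * max (q z) (q x)) b"
    by (simp add: a b distrib_left)
next
  show "(\<lambda>(z, x). N * max (q z) (q x)) 0 = 0"
    by (simp add: zero_prod_def seminorm_0[OF q])
next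
  fix c :: real and a :: "'a \<times> 'a"
  assume "c > 0"
  then have "max (c * q z) (c * q x) = c * max (q z) (q x)" for z x
    by (simp add: max_mult_distrib_left)
  with \<open>c > 0\<close> show "(\<lambda>(z, x). N * max (q z) (q x)) (c *\<^sub>R a) \<le> c * (\<lambda>(z, x). N * max (q z) (q x)) a"
    by (cases a) (simp add: seminorm_scale[OF q])
qed

lemma dual_seminorm_add_le:
  assumes q: "seminorm q" and v: "linear v" and w: "linear w"
    and le: "\<And>z x. v z - w x \<le> N * max (q z) (q x)" and N: "N \<ge> 0"
  shows "v \<in> seminorm_dual q" "w \<in> seminorm_dual q" "dual_seminorm q v + dual_seminorm q w \<le> N"
proof -
  have v_le: "v z \<le> N * q z" for z
    using le[of z 0] seminorm_nonneg[OF q, of z]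
    by (simp add: linear_0[OF w] seminorm_0[OF q] max_def)
  have w_le: "- w x \<le> N * q x" for x
    using le[of 0 x] seminorm_nonneg[OF q, of x]
    by (simp add: linear_0[OF v] seminorm_0[OF q] max_def split: if_splits)
  have abs_v: "\<bar>v z\<bar> \<le> N * q z" for z
    using v_le[of z] v_le[of "- z"] by (simp add: linear_neg[OF v] seminorm_minus[OF q])
  have abs_w: "\<bar>w x\<bar> \<le> N * q x" for x
    using w_le[of x] w_le[of "- x"] by (simp add: linear_neg[OF w] seminorm_minus[OF q])
  show "v \<in> seminorm_dual q" and wd: "w \<in> seminorm_dual q"
    using v w abs_v abs_w N by (auto simp: seminorm_dual_def)
  have bound: "v z - w x \<le> N" if "q z \<le> 1" "q x \<le> 1" for z x
    using le[of z x] mult_left_mono[of "max (q z) (q x)" 1 N] N that by simp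
  (* The joint bound is optimised over x first, with z held fixed in the unit ball, then over z. *)
  have "v z \<le> N - dual_seminorm q w" if z: "q z \<le> 1" for z
  proof -
    have "w x \<le> N - v z" if "q x \<le> 1" for x
      using bound[OF z, of "- x"] that by (simp add: linear_neg[OF w] seminorm_minus[OF q])
    then have "\<bar>w x\<bar> \<le> (N - v z) * q x" for x
      by (rule abs_le_of_le_on_ball[OF q w])
    moreover have "0 \<le> N - v z"
      using bound[OF z, of 0] by (simp add: linear_0[OF w] seminorm_0[OF q])
    ultimately have "dual_seminorm q w \<le> N - v z" by (intro dual_seminorm_le)
    then show ?thesis by simp
  qed
  then have "\<bar>v z\<bar> \<le> (N - dual_seminorm q w) * q z" for z
    by (rule abs_le_of_le_on_ball[OF q v])
  moreover have "0 \<le> N - dual_seminorm q w"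
    using dual_seminorm_le[of N w q] N abs_w by simp
  ultimately have "dual_seminorm q v \<le> N - dual_seminorm q w" by (intro dual_seminorm_le)
  then show "dual_seminorm q v + dual_seminorm q w \<le> N" by simp
qed

text \<open>
  Let \<open>N\<close> be the dual seminorm of \<open>u\<close>.  The functional \<open>F (z, x) = v1 z - v2 x\<close> on \<open>E \<times> E\<close> must
  satisfy \<open>F (y, y) \<ge> u y\<close> for all \<open>y\<close>, be nonnegative at \<open>(l, 0)\<close> and \<open>(0, - m)\<close> for \<open>l\<close>, \<open>m\<close> in
  \<open>K\<close>, and lie below \<open>N * max (q z) (q x)\<close>.  These requirements are compatible because
  \<open>y - m \<le> y \<le> y + l\<close> gives \<open>u y \<le> N * q y \<le> N * max (q (y + l)) (q (y - m))\<close>.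
\<close>

lemma le_max_between_decomposition:
  assumes q: "seminorm q" and K: "convex_cone K" and between: "le_max_between K q"
    and u: "u \<in> seminorm_dual q"
  obtains v1 v2 where "v1 \<in> positive_dual K q" "v2 \<in> positive_dual K q"
    "\<And>x. u x = v1 x - v2 x"
    "dual_seminorm q u = dual_seminorm q v1 + dual_seminorm q v2"
proof -
  define N where "N = dual_seminorm q u"
  have N: "N \<ge> 0" unfolding N_def using u by (rule dual_seminorm_nonneg)
  have lin_u: "linear u" using u by (simp add: seminorm_dual_def)
  let ?g = "\<lambda>(z, x). N * max (q z) (q x)"
  let ?D = "{((y + l, y - m), u y) | y l m. l \<in> K \<and> m \<in> K}"
  have K0: "0 \<in> K" using K by (simp add: convex_cone_iff)
  have mem: "((y + l, y - m), u y) \<in> ?D" if "l \<in> K" "m \<in> K" for y l m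
    using that by blast
  have cone: "convex_cone ?D"
    unfolding convex_cone_iff
  proof (intro conjI ballI allI impI)
    show "0 \<in> ?D" using mem[of 0 0 0] K0 by (simp add: zero_prod_def linear_0[OF lin_u])
  next
    fix d e assume "d \<in> ?D" "e \<in> ?D"
    then obtain y l m y' l' m' where "d = ((y + l, y - m), u y)" "l \<in> K" "m \<in> K"
        "e = ((y' + l', y' - m'), u y')" "l' \<in> K" "m' \<in> K"
      by blast
    then show "d + e \<in> ?D"
      using mem[of "l + l'" "m + m'" "y + y'"] convex_cone_add[OF K]
      by (simp add: algebra_simps linear_add[OF lin_u])
  next
    fix d and c :: real assume "d \<in> ?D" "0 \<le> c"
    then obtain y l m where "d = ((y + l, y - m), u y)" "l \<in> K" "m \<in> K"
      by blast
    then show "c *\<^sub>R d \<in> ?D"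
      using mem[of "c *\<^sub>R l" "c *\<^sub>R m" "c *\<^sub>R y"] convex_cone_scaleR[OF K \<open>0 \<le> c\<close>]
      by (simp add: algebra_simps linear_scale[OF lin_u])
  qed
  have compatible: "r \<le> ?g c" if "(c, r) \<in> ?D" for c r
  proof -
    from that obtain y l m where *: "c = (y + l, y - m)" "r = u y" "l \<in> K" "m \<in> K" by blast
    have "u y \<le> N * q y"
      using dual_seminorm_bound[OF q u, of y] by (simp add: N_def)
    also have "\<dots> \<le> N * max (q (y + l)) (q (y - m))"
      using le_max_betweenD[OF between, of y "y - m" "y + l"] * N
      by (intro mult_left_mono) (auto simp: max.commute)
    finally show ?thesis using * by simp
  qed
  obtain F where F: "linear F" "\<And>c. F c \<le> ?g c" "\<And>c r. (c, r) \<in> ?D \<Longrightarrow> r \<le> F c"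
    using sublinear_sandwich[OF sublinear_max[OF q N] cone compatible] by blast
  define v1 where "v1 z = F (z, 0)" for z
  define v2 where "v2 x = - F (0, x)" for x
  have lin1: "linear v1"
    using linear_add[OF F(1), of "(z, 0)" "(z', 0)" for z z']
      linear_scale[OF F(1), of _ "(z, 0)" for z]
    by (intro linearI) (simp_all add: v1_def)
  have lin2: "linear v2"
    using linear_add[OF F(1), of "(0, x)" "(0, x')" for x x']
      linear_scale[OF F(1), of _ "(0, x)" for x]
    by (intro linearI) (simp_all add: v2_def)
  have F_eq: "F (z, x) = v1 z - v2 x" for z x
    using linear_add[OF F(1), of "(z, 0)" "(0, x)"] by (simp add: v1_def v2_def)
  have split: "u x = v1 x - v2 x" for x
  proof -
    (* A lower bound on the diagonal, a subspace, is an equality: compare at x and at - x. *)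
    have le: "u y \<le> v1 y - v2 y" for y
      using F(3)[OF mem[OF K0 K0, of y]] by (simp add: F_eq)
    show ?thesis
      using le[of x] le[of "- x"]
      by (simp add: linear_neg[OF lin_u] linear_neg[OF lin1] linear_neg[OF lin2])
  qed
  have "v1 z - v2 x \<le> N * max (q z) (q x)" for z x
    using F(2)[of "(z, x)"] by (simp add: F_eq)
  note dual = dual_seminorm_add_le[OF q lin1 lin2 this N]
  have pos: "0 \<le> v1 l" "0 \<le> v2 l" if "l \<in> K" for l
    using F(3)[OF mem[OF that K0, of 0]] F(3)[OF mem[OF K0 that, of 0]]
    by (simp_all add: F_eq linear_0[OF lin_u] linear_0[OF lin1] linear_0[OF lin2] linear_neg[OF lin2])
  have "N \<le> dual_seminorm q v1 + dual_seminorm q v2"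
    unfolding N_def
  proof (rule dual_seminorm_le)
    show "0 \<le> dual_seminorm q v1 + dual_seminorm q v2"
      using dual(1,2) by (simp add: dual_seminorm_nonneg)
    show "\<bar>u x\<bar> \<le> (dual_seminorm q v1 + dual_seminorm q v2) * q x" for x
      using dual_seminorm_bound[OF q dual(1), of x] dual_seminorm_bound[OF q dual(2), of x]
      by (simp add: split distrib_right)
  qed
  with dual(3) have "dual_seminorm q u = dual_seminorm q v1 + dual_seminorm q v2"
    by (simp add: N_def)
  then show thesis
    using that[of v1 v2] dual(1,2) pos split by (simp add: positive_dual_def)
qed

text \<open>
  For the reverse direction, a functional \<open>u\<close> of dual seminorm at most \<open>1\<close> attaining \<open>q y\<close> is
  decomposed; then \<open>x \<le> y \<le> z\<close> gives
  \<open>q y = v1 y - v2 y \<le> v1 z - v2 x \<le> |v1| * q z + |v2| * q x \<le> max (q x) (q z)\<close>.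
\<close>

lemma le_max_between_iff_decomposition:
  assumes q: "seminorm q" and K: "convex_cone K"
  shows "le_max_between K q \<longleftrightarrow>
    (\<forall>u\<in>seminorm_dual q. \<exists>v1\<in>positive_dual K q. \<exists>v2\<in>positive_dual K q.
      (\<forall>x. u x = v1 x - v2 x) \<and>
      dual_seminorm q u = dual_seminorm q v1 + dual_seminorm q v2)" (is "_ \<longleftrightarrow> ?R")
proof
  assume "le_max_between K q"
  then show ?R using le_max_between_decomposition[OF q K] by metis
next
  assume R: ?R
  show "le_max_between K q"
    unfolding le_max_between_def cone_le_def
  proof (intro allI impI)
    fix x y z
    assume xyz: "y - x \<in> K \<and> z - y \<in> K"
    have "convex_cone {0 :: 'a}" by (simp add: convex_cone_iff)
    then obtain u where u: "linear u" "\<And>w. \<bar>u w\<bar> \<le> q w" "u y = q y"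
      using norming_positive_functional[OF q, of "{0}" y] by auto
    have "u \<in> seminorm_dual q"
      using u(1,2) by (auto simp: seminorm_dual_def intro!: exI[of _ 1])
    with R obtain v1 v2 where v: "v1 \<in> positive_dual K q" "v2 \<in> positive_dual K q"
        "u y = v1 y - v2 y" "dual_seminorm q u = dual_seminorm q v1 + dual_seminorm q v2"
      by meson
    let ?M = "max (q x) (q z)"
    have vd: "v1 \<in> seminorm_dual q" "v2 \<in> seminorm_dual q" "linear v1" "linear v2"
      using v(1,2) by (auto simp: positive_dual_def seminorm_dual_def)
    have "v1 y \<le> v1 z" "v2 x \<le> v2 y"
      using v(1,2) xyz linear_diff[OF vd(3), of z y] linear_diff[OF vd(4), of y x]
      by (force simp: positive_dual_def)+
    moreover have "v1 z \<le> dual_seminorm q v1 * ?M"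
      using dual_seminorm_bound[OF q vd(1), of z]
        mult_left_mono[OF max.cobounded2[of "q z" "q x"] dual_seminorm_nonneg[OF vd(1)]]
      by linarith
    moreover have "- v2 x \<le> dual_seminorm q v2 * ?M"
      using dual_seminorm_bound[OF q vd(2), of x]
        mult_left_mono[OF max.cobounded1[of "q x" "q z"] dual_seminorm_nonneg[OF vd(2)]]
      by linarith
    ultimately have "q y \<le> dual_seminorm q u * ?M"
      using u(3) v(3) by (simp add: v(4) distrib_right)
    also have "\<dots> \<le> 1 * ?M"
      using dual_seminorm_le[of 1 u q] u(2) seminorm_nonneg[OF q, of x]
      by (intro mult_right_mono) auto
    finally show "q y \<le> ?M" by simp
  qed
qed

section \<open>Equivalence for calibrated ordered spaces\<close>

lemma ordering_cone_convex_cone: "ordering_cone K \<Longrightarrow> convex_cone K"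
  unfolding ordering_cone_def convex_cone_iff
  by (metis IntD1 add.right_neutral scaleR_one singletonI zero_le_one)

theorem theorem4p10:
  fixes K :: "'e::real_vector set"
    and A :: "'i set"
    and p :: "'i \<Rightarrow> 'e \<Rightarrow> real"
  assumes "calibrated_ordered_space K A p"
    and "closedin (seminorm_topology A p) K"
  shows
    "let c1 = (\<forall>\<alpha>\<in>A. \<forall>x0. \<exists>f\<in>positive_dual_ball K (p \<alpha>).
                 is_state K (p \<alpha>) f \<and> \<bar>f x0\<bar> = p \<alpha> x0);
         c2 = (\<forall>\<alpha>\<in>A. \<forall>x. (\<forall>l\<in>K. p \<alpha> (x + l) \<ge> p \<alpha> x) \<or> (\<forall>l\<in>K. p \<alpha> (x - l) \<ge> p \<alpha> x));
         c3 = (\<forall>\<alpha>\<in>A. full_set K {x. p \<alpha> x \<le> 1});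
         c4 = (\<forall>x y z. cone_le K x y \<and> cone_le K y z \<longrightarrow>
                 (\<forall>\<alpha>\<in>A. p \<alpha> y \<le> max (p \<alpha> x) (p \<alpha> z)));
         c5 = (\<forall>\<alpha>\<in>A. \<forall>u\<in>seminorm_dual (p \<alpha>).
                 \<exists>v1\<in>positive_dual K (p \<alpha>). \<exists>v2\<in>positive_dual K (p \<alpha>).
                   (\<forall>x. u x = v1 x - v2 x) \<and>
                   dual_seminorm (p \<alpha>) u = dual_seminorm (p \<alpha>) v1 + dual_seminorm (p \<alpha>) v2);
         c6 = (\<forall>\<alpha>\<in>A. \<forall>x0. (SUP f\<in>positive_dual_ball K (p \<alpha>). \<bar>f x0\<bar>) = p \<alpha> x0)
     in ((\<forall>\<alpha>\<in>A. \<exists>x. p \<alpha> x \<noteq> 0) \<longrightarrow> (c1 \<longleftrightarrow> c2)) \<and>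
        (c2 \<longleftrightarrow> c3) \<and> (c3 \<longleftrightarrow> c4) \<and> (c4 \<longleftrightarrow> c5) \<and> (c5 \<longleftrightarrow> c6)"
proof -
  interpret calibrated_ordered_space K A p by (rule assms(1))
  have K: "convex_cone K" using cone by (rule ordering_cone_convex_cone)
  have between: "(\<forall>x y z. cone_le K x y \<and> cone_le K y z \<longrightarrow>
      (\<forall>\<alpha>\<in>A. p \<alpha> y \<le> max (p \<alpha> x) (p \<alpha> z))) \<longleftrightarrow> (\<forall>\<alpha>\<in>A. le_max_between K (p \<alpha>))"
    by (auto simp: le_max_between_def)
  have states: "(\<forall>\<alpha>\<in>A. \<forall>x0. \<exists>f\<in>positive_dual_ball K (p \<alpha>). is_state K (p \<alpha>) f \<and> \<bar>f x0\<bar> = p \<alpha> x0)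
      \<longleftrightarrow> (\<forall>\<alpha>\<in>A. le_max_between K (p \<alpha>))" if "\<forall>\<alpha>\<in>A. \<exists>x. p \<alpha> x \<noteq> 0"
    using that by (intro ball_cong refl le_max_between_iff_states[symmetric] seminorms K) auto
  have one_sided: "(\<forall>\<alpha>\<in>A. \<forall>x. (\<forall>l\<in>K. p \<alpha> (x + l) \<ge> p \<alpha> x) \<or> (\<forall>l\<in>K. p \<alpha> (x - l) \<ge> p \<alpha> x))
      \<longleftrightarrow> (\<forall>\<alpha>\<in>A. le_max_between K (p \<alpha>))"
    by (intro ball_cong refl le_max_between_iff_one_sided[symmetric])
  have full: "(\<forall>\<alpha>\<in>A. full_set K {x. p \<alpha> x \<le> 1}) \<longleftrightarrow> (\<forall>\<alpha>\<in>A. le_max_between K (p \<alpha>))"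
    by (intro ball_cong refl full_ball_iff_le_max_between seminorms K)
  have decomposition: "(\<forall>\<alpha>\<in>A. \<forall>u\<in>seminorm_dual (p \<alpha>).
        \<exists>v1\<in>positive_dual K (p \<alpha>). \<exists>v2\<in>positive_dual K (p \<alpha>).
          (\<forall>x. u x = v1 x - v2 x) \<and>
          dual_seminorm (p \<alpha>) u = dual_seminorm (p \<alpha>) v1 + dual_seminorm (p \<alpha>) v2)
      \<longleftrightarrow> (\<forall>\<alpha>\<in>A. le_max_between K (p \<alpha>))"
    by (intro ball_cong refl le_max_between_iff_decomposition[symmetric] seminorms K)
  have sup: "(\<forall>\<alpha>\<in>A. \<forall>x0. (SUP f\<in>positive_dual_ball K (p \<alpha>). \<bar>f x0\<bar>) = p \<alpha> x0)
      \<longleftrightarrow> (\<forall>\<alpha>\<in>A. le_max_between K (p \<alpha>))"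
    by (intro ball_cong refl le_max_between_iff_SUP[symmetric] seminorms K)
  show ?thesis
    unfolding Let_def between one_sided full decomposition sup
    using states by simp
qed

end
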